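(* Let $k\geq 1$ be an integer and let $T$ be a tournament with $4k+2$ vertices. If the simplicity index of $T$ satisfies $s(T)=2k$, then $T$ is obtained from a doubly regular tournament by removing one vertex.
   Context: A tournament $T=(V,A)$ consists of a finite vertex set $V$ and a set $A$ of ordered pairs of distinct vertices (arcs) such that for all $x\neq y\in V$, $(x,y)\in A$ if and only if $(y,x)\notin A$. One writes $x\rightarrow y$ ($x$ dominates $y$) when $(x,y)\in A$. A tournament is doubly regular if there is an integer $m\geq 1$ such that for every unordered pair $\{x,y\}$ of distinct vertices there are exactly $m$ vertices $z$ with $x\rightarrow z$ and $y\rightarrow z$. Removing a vertex means taking the subtournament induced by the remaining vertices. A module of $T$ is a subset $M\subseteq V$ such that for every $x\in V\setminus M$, either $m\rightarrow x$ for all $m\in M$, or $x\rightarrow m$ for all $m\in M$. The trivial modules are $\emptyset$, the singletons and $V$. A tournament with $n$ vertices is simple if $n\geq 3$ and all its modules are trivial. For a tournament $T$ with at least $3$ vertices, the simplicity index $s(T)$ is the minimum number of arcs of $T$ whose reversal yields a non-simple tournament (so $s(T)=0$ if $T$ is not simple). *)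

theory Defs
  imports "Graph_Theory.Graph_Theory"
begin

locale tournament = pair_digraph T for T :: "'a pair_pre_digraph" (structure) +
  assumes arc_iff: "\<And>x y. \<lbrakk>x \<in> pverts T; y \<in> pverts T; x \<noteq> y\<rbrakk> \<Longrightarrow>
    (x, y) \<in> parcs T \<longleftrightarrow> (y, x) \<notin> parcs T"

locale doubly_regular_tournament = tournament +
  assumes doubly_regular: "\<exists>m\<ge>1. \<forall>x\<in>pverts T. \<forall>y\<in>pverts T. x \<noteq> y \<longrightarrow>
    card {z \<in> pverts T. (x, z) \<in> parcs T \<and> (y, z) \<in> parcs T} = m"

definition tmodule :: "'a pair_pre_digraph \<Rightarrow> 'a set \<Rightarrow> bool" where
  "tmodule T M \<longleftrightarrow> M \<subseteq> pverts T \<and>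
    (\<forall>x\<in>pverts T - M. (\<forall>m\<in>M. (m, x) \<in> parcs T) \<or> (\<forall>m\<in>M. (x, m) \<in> parcs T))"

definition simple_tournament :: "'a pair_pre_digraph \<Rightarrow> bool" where
  "simple_tournament T \<longleftrightarrow> tournament T \<and> card (pverts T) \<ge> 3 \<and>
    (\<forall>M. tmodule T M \<longrightarrow> M = {} \<or> is_singleton M \<or> M = pverts T)"

definition reverse_arcs :: "'a pair_pre_digraph \<Rightarrow> 'a rel \<Rightarrow> 'a pair_pre_digraph" where
  "reverse_arcs T R = T\<lparr>parcs := (parcs T - R) \<union> R\<inverse>\<rparr>"

text \<open>Intended for tournaments with at least three vertices: making one vertex dominate all
  others by reversals creates a nontrivial module, so the minimum is then attained.\<close>

definition simplicity_index :: "'a pair_pre_digraph \<Rightarrow> nat" where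
  "simplicity_index T =
    (LEAST n. \<exists>R\<subseteq>parcs T. card R = n \<and> \<not> simple_tournament (reverse_arcs T R))"

text \<open>The type of \<open>T\<close> may have no spare vertex, so the larger tournament \<open>D\<close> lives on the
  type extended by one point and the removal of \<open>v\<close> yields \<open>T\<close> up to isomorphism.\<close>

definition doubly_regular_minus_vertex :: "'a pair_pre_digraph \<Rightarrow> bool" where
  "doubly_regular_minus_vertex T \<longleftrightarrow>
    (\<exists>(D :: 'a option pair_pre_digraph) v. doubly_regular_tournament D \<and> v \<in> pverts D \<and>
      digraph_iso (induce_subgraph (with_proj D) (pverts D - {v})) (with_proj T))"

end

theory Submission
  imports Defs
begin

text \<open>Making all vertices but one, or just two vertices, a module by reversals shows that every
  vertex has at least \<open>2k\<close> out- and in-neighbours and that any two vertices are separated by at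
  least \<open>2k\<close> others. The out-degrees are therefore \<open>2k\<close> or \<open>2k + 1\<close>, and each value is attained
  equally often, so a new vertex dominated by the vertices of out-degree \<open>2k\<close> and dominating the
  others yields a regular tournament on \<open>4k + 3\<close> vertices. In a regular tournament two vertices are
  separated by an odd number of others, so old vertices are separated by at least \<open>2k + 1\<close> others,
  which means that they have at most \<open>k\<close> common out-neighbours. Double counting turns these
  inequalities into equalities.\<close>

section \<open>Neighbourhoods, separators and reversals\<close>

abbreviation out_nbrs :: "'a pair_pre_digraph \<Rightarrow> 'a \<Rightarrow> 'a set" where
  "out_nbrs T x \<equiv> parcs T `` {x}"

abbreviation in_nbrs :: "'a pair_pre_digraph \<Rightarrow> 'a \<Rightarrow> 'a set" where
  "in_nbrs T x \<equiv> (parcs T)\<inverse> `` {x}"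

text \<open>In a tournament, these are the vertices that prevent \<open>{x, y}\<close> from being a
  module.\<close>

definition separators :: "'a pair_pre_digraph \<Rightarrow> 'a \<Rightarrow> 'a \<Rightarrow> 'a set" where
  "separators T x y =
    {z. (x, z) \<in> parcs T \<and> (z, y) \<in> parcs T \<or> (y, z) \<in> parcs T \<and> (z, x) \<in> parcs T}"

text \<open>Reversal keeps the vertex set, so a nontrivial module \<open>M\<close> after reversing
  \<open>R\<close> makes \<open>card R\<close> a competitor in the minimum.\<close>

lemma simplicity_index_le:
  assumes "R \<subseteq> parcs T" "tmodule (reverse_arcs T R) M"
    and "M \<noteq> {}" "\<not> is_singleton M" "M \<noteq> pverts T"
  shows "simplicity_index T \<le> card R"
proof -
  have "\<not> simple_tournament (reverse_arcs T R)"
    using assms by (auto simp: simple_tournament_def reverse_arcs_def)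
  then show ?thesis
    unfolding simplicity_index_def using assms(1) by (intro Least_le) blast
qed

section \<open>Degrees and common out-neighbours in a tournament\<close>

context tournament
begin

lemma no_loop: "(x, x) \<notin> parcs T"
  using pair_no_loops[of "(x, x)"] by auto

lemma asym: "(x, y) \<in> parcs T \<Longrightarrow> (y, x) \<notin> parcs T"
  using arc_iff[of x y] no_loop in_arcsD1 in_arcsD2 by blast

lemma total: "x \<in> pverts T \<Longrightarrow> y \<in> pverts T \<Longrightarrow> x \<noteq> y \<Longrightarrow> (x, y) \<in> parcs T \<or> (y, x) \<in> parcs T"
  using arc_iff[of x y] by blast

lemma finite_nbrs: "finite (out_nbrs T x)" "finite (in_nbrs T x)"
  by (auto intro!: finite_subset[OF _ pair_finite_verts] dest: in_arcsD1 in_arcsD2)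

lemma card_out_add_card_in:
  assumes "x \<in> pverts T"
  shows "card (out_nbrs T x) + card (in_nbrs T x) + 1 = card (pverts T)"
proof -
  have "pverts T = insert x (out_nbrs T x \<union> in_nbrs T x)"
    using assms total[OF assms] by (auto dest: in_arcsD1 in_arcsD2)
  moreover have "x \<notin> out_nbrs T x \<union> in_nbrs T x" "out_nbrs T x \<inter> in_nbrs T x = {}"
    using no_loop asym by auto
  ultimately show ?thesis
    using finite_nbrs[of x] by (simp add: card_Un_disjoint)
qed

text \<open>Both sums count the arcs, by tail and by head.\<close>

lemma sum_card_out_eq_in:
  "(\<Sum>x\<in>pverts T. card (out_nbrs T x)) = (\<Sum>x\<in>pverts T. card (in_nbrs T x))"
proof -
  have "(\<Sum>x\<in>pverts T. card (out_nbrs T x)) = (\<Sum>x\<in>pverts T. card {y \<in> pverts T. (x, y) \<in> parcs T})"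
    by (intro sum.cong refl arg_cong[where f = card]) (auto dest: in_arcsD2)
  also have "\<dots> = (\<Sum>y\<in>pverts T. card {x \<in> pverts T. (x, y) \<in> parcs T})"
    by (rule sum_multicount_gen) (auto simp: pair_finite_verts)
  also have "\<dots> = (\<Sum>y\<in>pverts T. card (in_nbrs T y))"
    by (intro sum.cong refl arg_cong[where f = card]) (auto dest: in_arcsD1)
  finally show ?thesis .
qed

text \<open>Both sides count the pairs of some \<open>y\<close> other than \<open>x\<close> and some
  \<open>z\<close> dominated by both. The subtracted 1 is \<open>x\<close>, which lies in
  \<open>in_nbrs T z\<close>.\<close>

lemma sum_card_common_out:
  assumes "x \<in> pverts T"
  shows "(\<Sum>y\<in>pverts T - {x}. card (out_nbrs T x \<inter> out_nbrs T y)) =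
    (\<Sum>z\<in>out_nbrs T x. card (in_nbrs T z) - 1)"
proof -
  have "(\<Sum>y\<in>pverts T - {x}. card (out_nbrs T x \<inter> out_nbrs T y)) =
      (\<Sum>y\<in>pverts T - {x}. card {z \<in> out_nbrs T x. (y, z) \<in> parcs T})"
    by (intro sum.cong refl arg_cong[where f = card]) auto
  also have "\<dots> = (\<Sum>z\<in>out_nbrs T x. card {y \<in> pverts T - {x}. (y, z) \<in> parcs T})"
    by (rule sum_multicount_gen) (auto simp: pair_finite_verts finite_nbrs)
  also have "\<dots> = (\<Sum>z\<in>out_nbrs T x. card (in_nbrs T z) - 1)"
  proof (rule sum.cong[OF refl])
    fix z assume "z \<in> out_nbrs T x"
    moreover have "{y \<in> pverts T - {x}. (y, z) \<in> parcs T} = in_nbrs T z - {x}"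
      by (auto dest: in_arcsD1)
    ultimately show "card {y \<in> pverts T - {x}. (y, z) \<in> parcs T} = card (in_nbrs T z) - 1"
      by simp
  qed
  finally show ?thesis .
qed

text \<open>Adding the two out-degrees counts common out-neighbours twice and each separator once;
  the remaining 1 is the arc joining \<open>x\<close> and \<open>y\<close>.\<close>

lemma card_common_out_separators:
  assumes "x \<in> pverts T" "y \<in> pverts T" "x \<noteq> y"
  shows "2 * card (out_nbrs T x \<inter> out_nbrs T y) + card (separators T x y) + 1 =
    card (out_nbrs T x) + card (out_nbrs T y)"
proof -
  \<comment> \<open>By symmetry it suffices to treat the orientation in which \<open>y\<close> is
    itself an out-neighbour of \<open>x\<close>.\<close>
  have split_xy: "card (out_nbrs T x) + card (out_nbrs T y) =
      2 * card (out_nbrs T x \<inter> out_nbrs T y) + card (separators T x y) + 1"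
    if arc: "(x, y) \<in> parcs T" for x y
  proof -
    let ?C = "out_nbrs T x \<inter> out_nbrs T y"
    let ?X = "{z. (x, z) \<in> parcs T \<and> (z, y) \<in> parcs T}"
    let ?Y = "{z. (y, z) \<in> parcs T \<and> (z, x) \<in> parcs T}"
    have V: "x \<in> pverts T" "y \<in> pverts T"
      using arc by (auto dest: in_arcsD1 in_arcsD2)
    have fin: "finite ?C" "finite ?X" "finite ?Y"
      using finite_nbrs by (auto intro: finite_subset[OF _ finite_nbrs(1)])
    have "card (out_nbrs T x) = card (insert y (?C \<union> ?X))"
      using arc total[OF _ V(2)] by (intro arg_cong[where f = card]) (auto dest: in_arcsD2)
    also have "\<dots> = card (?C \<union> ?X) + 1"
      using fin no_loop by simp
    also have "card (?C \<union> ?X) = card ?C + card ?X"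
      using fin asym by (intro card_Un_disjoint) auto
    finally have "card (out_nbrs T x) = card ?C + card ?X + 1" .
    moreover have "card (out_nbrs T y) = card (?C \<union> ?Y)"
      using asym[OF arc] total[OF _ V(1)] by (intro arg_cong[where f = card]) (auto dest: in_arcsD2)
    moreover have "card (?C \<union> ?Y) = card ?C + card ?Y"
      using fin asym by (intro card_Un_disjoint) auto
    moreover have "card (separators T x y) = card (?X \<union> ?Y)"
      by (intro arg_cong[where f = card]) (auto simp: separators_def)
    moreover have "card (?X \<union> ?Y) = card ?X + card ?Y"
      using fin asym by (intro card_Un_disjoint) auto
    ultimately show ?thesis
      by simp
  qed
  have "separators T y x = separators T x y"
    by (auto simp: separators_def)
  then show ?thesis
    using total[OF assms] split_xy[of x y] split_xy[of y x] by (auto simp: Int_commute)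
qed

section \<open>Bounds on degrees and separators from the simplicity index\<close>

text \<open>Reversing all arcs that leave \<open>x\<close>, or all that enter it, makes
  \<open>x\<close> a sink or a source and the other vertices a module, nontrivial since there are at
  least two of them.\<close>

lemma simplicity_index_le_card_nbrs:
  assumes "x \<in> pverts T" "card (pverts T) \<ge> 3"
  shows "simplicity_index T \<le> card (out_nbrs T x)" "simplicity_index T \<le> card (in_nbrs T x)"
proof -
  let ?M = "pverts T - {x}"
  have "card ?M \<ge> 2"
    using assms by simp
  then have "card ?M \<noteq> 0" "card ?M \<noteq> 1"
    by linarith+
  then have M: "?M \<noteq> {}" "\<not> is_singleton ?M" "?M \<noteq> pverts T"
    unfolding is_singleton_altdef using assms(1) by (metis card.empty, blast+)
  have "simplicity_index T \<le> card (Pair x ` out_nbrs T x)"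
    by (rule simplicity_index_le[OF _ _ M])
      (use total[OF assms(1)] in \<open>auto simp: tmodule_def reverse_arcs_def\<close>)
  then show "simplicity_index T \<le> card (out_nbrs T x)"
    by (simp add: card_image inj_on_def)
  have "simplicity_index T \<le> card ((\<lambda>z. (z, x)) ` in_nbrs T x)"
    by (rule simplicity_index_le[OF _ _ M])
      (use total[OF assms(1)] in \<open>auto simp: tmodule_def reverse_arcs_def\<close>)
  then show "simplicity_index T \<le> card (in_nbrs T x)"
    by (simp add: card_image inj_on_def)
qed

text \<open>Reversing the arc between \<open>y\<close> and each separator makes \<open>y\<close>
  agree with \<open>x\<close> on all other vertices, which turns the pair into a module.\<close>

lemma simplicity_index_le_card_separators:
  assumes "x \<in> pverts T" "y \<in> pverts T" "x \<noteq> y" "card (pverts T) \<ge> 3"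
  shows "simplicity_index T \<le> card (separators T x y)"
proof -
  \<comment> \<open>For a separator \<open>z\<close>, this is the arc joining \<open>y\<close> and
    \<open>z\<close> in its actual direction.\<close>
  let ?f = "\<lambda>z. if (y, z) \<in> parcs T then (y, z) else (z, y)"
  let ?R = "?f ` separators T x y"
  have "simplicity_index T \<le> card ?R"
  proof (rule simplicity_index_le)
    show "?R \<subseteq> parcs T"
      by (auto simp: separators_def)
    have "z \<noteq> y" if "z \<in> separators T x y" for z
      using that no_loop by (auto simp: separators_def)
    then have R: "(y, z) \<in> ?R \<longleftrightarrow> (y, z) \<in> parcs T \<and> (z, x) \<in> parcs T"
      "(z, y) \<in> ?R \<longleftrightarrow> (z, y) \<in> parcs T \<and> (x, z) \<in> parcs T" for z
      using asym by (auto simp: separators_def image_iff split: if_splits)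
    \<comment> \<open>Every reversed arc is incident to \<open>y\<close> and avoids
      \<open>x\<close>, so \<open>x\<close> keeps its arcs to third vertices.\<close>
    have R': "(x, z) \<notin> ?R \<and> (z, x) \<notin> ?R" if "z \<noteq> y" for z
      using that assms(3) no_loop by (auto simp: separators_def split: if_splits)
    show "tmodule (reverse_arcs T ?R) {x, y}"
      unfolding tmodule_def
    proof (intro conjI ballI)
      show "{x, y} \<subseteq> pverts (reverse_arcs T ?R)"
        using assms by (simp add: reverse_arcs_def)
      fix z assume "z \<in> pverts (reverse_arcs T ?R) - {x, y}"
      then have z: "z \<in> pverts T" "z \<noteq> x" "z \<noteq> y"
        by (auto simp: reverse_arcs_def)
      have arcs: "parcs (reverse_arcs T ?R) = (parcs T - ?R) \<union> ?R\<inverse>"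
        by (simp add: reverse_arcs_def)
      show "(\<forall>m\<in>{x, y}. (m, z) \<in> parcs (reverse_arcs T ?R)) \<or>
          (\<forall>m\<in>{x, y}. (z, m) \<in> parcs (reverse_arcs T ?R))"
        unfolding arcs Un_iff Diff_iff converse_iff ball_simps R R'[OF z(3)]
        using total[OF z(1) assms(1) z(2)] total[OF z(1) assms(2) z(3)] R R'[OF z(3)] asym by blast
    qed
    show "{x, y} \<noteq> {}" "\<not> is_singleton {x, y}"
      using assms(3) by (auto simp: is_singleton_altdef)
    show "{x, y} \<noteq> pverts T"
    proof
      assume "{x, y} = pverts T"
      then have "card (pverts T) = card {x, y}"
        by simp
      then show False
        using assms(3,4) by simp
    qed
  qed
  also have "\<dots> \<le> card (separators T x y)"
    by (intro card_image_le finite_subset[OF _ pair_finite_verts])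
      (auto simp: separators_def dest: in_arcsD1 in_arcsD2)
  finally show ?thesis .
qed

section \<open>Double regularity by double counting\<close>

text \<open>By regularity, the common out-neighbour counts at any vertex average \<open>k\<close>.
  The upper bound away from \<open>v\<close> forces the counts with \<open>v\<close> to be at least
  \<open>k\<close>, the average at \<open>v\<close> makes them equal to \<open>k\<close>, and the
  averages at the other vertices then make the upper bounds tight.\<close>

lemma doubly_regularI:
  assumes "k \<ge> 1" and V: "card (pverts T) = 4 * k + 3"
    and out: "\<And>x. x \<in> pverts T \<Longrightarrow> card (out_nbrs T x) = 2 * k + 1"
    and v: "v \<in> pverts T"
    and common_le: "\<And>x y. x \<in> pverts T - {v} \<Longrightarrow> y \<in> pverts T - {v} \<Longrightarrow> x \<noteq> y \<Longrightarrow>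
      card (out_nbrs T x \<inter> out_nbrs T y) \<le> k"
  shows "doubly_regular_tournament T"
proof -
  let ?c = "\<lambda>x y. card (out_nbrs T x \<inter> out_nbrs T y)"
  have "in": "card (in_nbrs T x) = 2 * k + 1" if "x \<in> pverts T" for x
    using card_out_add_card_in[OF that] out[OF that] V by simp
  \<comment> \<open>Each of the \<open>2 * k + 1\<close> out-neighbours of \<open>x\<close>
    contributes its in-degree minus one, that is \<open>2 * k\<close>.\<close>
  have sum_c: "(\<Sum>y\<in>pverts T - {x}. ?c x y) = (4 * k + 2) * k" if "x \<in> pverts T" for x
  proof -
    have "(\<Sum>z\<in>out_nbrs T x. card (in_nbrs T z) - 1) = (\<Sum>z\<in>out_nbrs T x. 2 * k)"
      by (rule sum.cong) (auto simp: "in" dest: in_arcsD2)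
    then show ?thesis
      by (simp add: sum_card_common_out[OF that] out[OF that] algebra_simps)
  qed
  have fin: "finite (pverts T)"
    by (rule pair_finite_verts)
  have sum_split: "?c x v + (\<Sum>y\<in>pverts T - {v} - {x}. ?c x y) = (4 * k + 2) * k"
    if "x \<in> pverts T - {v}" for x
  proof -
    have "pverts T - {x} - {v} = pverts T - {v} - {x}"
      by auto
    then have "(\<Sum>y\<in>pverts T - {x}. ?c x y) = ?c x v + (\<Sum>y\<in>pverts T - {v} - {x}. ?c x y)"
      using that v fin by (subst sum.remove[of _ v]) auto
    then show ?thesis
      using sum_c[of x] that by simp
  qed
  have card: "card (pverts T - {v} - {x}) = 4 * k + 1" if "x \<in> pverts T - {v}" for x
    using that v fin V by simp
  have c_v: "?c v x = k" if "x \<in> pverts T - {v}" for x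
  proof -
    \<comment> \<open>The other \<open>4 * k + 1\<close> terms at \<open>x\<close> are at most
      \<open>k\<close> each, so the term for \<open>v\<close> must supply the missing
      \<open>k\<close>.\<close>
    have ge: "k \<le> ?c v x" if x: "x \<in> pverts T - {v}" for x
    proof -
      have "(\<Sum>y\<in>pverts T - {v} - {x}. ?c x y) \<le> (4 * k + 1) * k"
        using sum_bounded_above[of "pverts T - {v} - {x}" "?c x" k] common_le[OF x] card[OF x]
        by auto
      then show ?thesis
        using sum_split[OF x] by (simp add: Int_commute[of _ "out_nbrs T v"] algebra_simps)
    qed
    \<comment> \<open>The lower bounds already add up to the whole sum at \<open>v\<close>, so each
      of them is an equality.\<close>
    have "(\<Sum>x\<in>pverts T - {v}. k) = (\<Sum>x\<in>pverts T - {v}. ?c v x)"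
      using sum_c[OF v] v V by simp
    then show ?thesis
      using sum_mono_inv[of "\<lambda>_. k" "pverts T - {v}" "?c v"] ge that fin by auto
  qed
  have c: "?c x y = k" if "x \<in> pverts T - {v}" "y \<in> pverts T - {v}" "x \<noteq> y" for x y
  proof -
    \<comment> \<open>Now that the term for \<open>v\<close> is known, the remaining terms add up to
      the sum of their upper bounds.\<close>
    have "(\<Sum>y\<in>pverts T - {v} - {x}. ?c x y) = (\<Sum>y\<in>pverts T - {v} - {x}. k)"
      using sum_split[OF that(1)] c_v[OF that(1)] card[OF that(1)]
      by (simp add: Int_commute[of _ "out_nbrs T v"] algebra_simps)
    then show ?thesis
      using sum_mono_inv[of "?c x" "pverts T - {v} - {x}" "\<lambda>_. k" y] common_le[OF that(1)] that fin
      by auto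
  qed
  have "card {z \<in> pverts T. (x, z) \<in> parcs T \<and> (y, z) \<in> parcs T} = k"
    if "x \<in> pverts T" "y \<in> pverts T" "x \<noteq> y" for x y
  proof -
    have "{z \<in> pverts T. (x, z) \<in> parcs T \<and> (y, z) \<in> parcs T} = out_nbrs T x \<inter> out_nbrs T y"
      by (auto dest: in_arcsD2)
    then show ?thesis
      using that c_v[of x] c_v[of y] c[of x y] by (cases "x = v"; cases "y = v") (auto simp: Int_commute)
  qed
  then show ?thesis
    using \<open>k \<ge> 1\<close> by unfold_locales blast
qed

end

section \<open>Extension by one vertex\<close>

text \<open>\<open>None\<close> is fresh whatever the old vertices are. Exactly the members of
  \<open>A\<close> gain an out-neighbour, so a suitable \<open>A\<close> evens out the
  out-degrees.\<close>

definition add_vertex :: "'a pair_pre_digraph \<Rightarrow> 'a set \<Rightarrow> 'a option pair_pre_digraph" where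
  "add_vertex T A = \<lparr>pverts = insert None (Some ` pverts T),
    parcs = map_prod Some Some ` parcs T \<union> (\<lambda>x. (Some x, None)) ` A \<union>
      (\<lambda>x. (None, Some x)) ` (pverts T - A)\<rparr>"

lemma pverts_add_vertex: "pverts (add_vertex T A) = insert None (Some ` pverts T)"
  by (simp add: add_vertex_def)

lemma parcs_add_vertex:
  "(Some x, Some y) \<in> parcs (add_vertex T A) \<longleftrightarrow> (x, y) \<in> parcs T"
  "(Some x, None) \<in> parcs (add_vertex T A) \<longleftrightarrow> x \<in> A"
  "(None, Some x) \<in> parcs (add_vertex T A) \<longleftrightarrow> x \<in> pverts T - A"
  "(None, None) \<notin> parcs (add_vertex T A)"
  by (auto simp: add_vertex_def)

lemma out_nbrs_add_vertex:
  "out_nbrs (add_vertex T A) (Some x) = Some ` out_nbrs T x \<union> (if x \<in> A then {None} else {})"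
  "out_nbrs (add_vertex T A) None = Some ` (pverts T - A)"
  by (auto simp: add_vertex_def)

context tournament
begin

lemma tournament_add_vertex:
  assumes "A \<subseteq> pverts T"
  shows "tournament (add_vertex T A)"
proof
  fix e assume "e \<in> parcs (add_vertex T A)"
  then show "fst e \<in> pverts (add_vertex T A)" "snd e \<in> pverts (add_vertex T A)" "fst e \<noteq> snd e"
    using assms no_loop by (auto simp: add_vertex_def dest: in_arcsD1 in_arcsD2)
next
  show "finite (pverts (add_vertex T A))" "finite (parcs (add_vertex T A))"
    using finite_subset[OF assms pair_finite_verts] pair_finite_verts pair_finite_arcs
    by (auto simp: add_vertex_def)
next
  fix x y assume "x \<in> pverts (add_vertex T A)" "y \<in> pverts (add_vertex T A)" "x \<noteq> y"
  then show "(x, y) \<in> parcs (add_vertex T A) \<longleftrightarrow> (y, x) \<notin> parcs (add_vertex T A)"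
    using assms by (cases x; cases y)
      (auto simp: pverts_add_vertex parcs_add_vertex dest: asym total)
qed

lemma digraph_iso_add_vertex:
  assumes "A \<subseteq> pverts T"
  shows "digraph_iso
    (induce_subgraph (with_proj (add_vertex T A)) (pverts (add_vertex T A) - {None})) (with_proj T)"
proof -
  let ?D = "add_vertex T A"
  let ?G = "induce_subgraph (with_proj ?D) (pverts ?D - {None})"
  \<comment> \<open>\<open>the\<close> undoes \<open>Some\<close>, hence is injective on the
    vertices left after removing \<open>None\<close>.\<close>
  let ?h = "\<lparr>iso_verts = the, iso_arcs = map_prod the the, iso_head = snd, iso_tail = fst\<rparr>"
  have verts: "verts ?G = Some ` pverts T"
    by (auto simp: pverts_add_vertex)
  have arcs: "arcs ?G = map_prod Some Some ` parcs T"
    by (auto simp: add_vertex_def induce_subgraph_def dest: in_arcsD1 in_arcsD2)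
  have "wf_digraph ?G"
    by unfold_locales auto
  then have "pre_digraph.digraph_isomorphism ?G ?h"
    unfolding pre_digraph.digraph_isomorphism_def verts arcs by (auto simp: inj_on_def)
  moreover have "with_proj T = app_iso ?h ?G"
    unfolding app_iso_def verts arcs by (simp add: with_proj_def image_image map_prod_def case_prod_unfold)
  ultimately show ?thesis
    unfolding digraph_iso_def by blast
qed

end

section \<open>Regular completion of a tournament with index \<open>2 * k\<close>\<close>

theorem theorem1p3:
  fixes k :: nat and T :: "'a pair_pre_digraph"
  assumes "k \<ge> 1"
    and "tournament T"
    and "card (pverts T) = 4 * k + 2"
    and "simplicity_index T = 2 * k"
  shows "doubly_regular_minus_vertex T"
proof -
  interpret tournament T by fact
  let ?V = "pverts T"
  \<comment> \<open>These vertices are one short of the out-degree \<open>2 * k + 1\<close> of a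
    regular tournament on \<open>4 * k + 3\<close> vertices; an arc to \<open>None\<close> makes up
    for it.\<close>
  define A where "A = {x \<in> ?V. card (out_nbrs T x) = 2 * k}"
  define B where "B = ?V - A"
  let ?D = "add_vertex T A"
  have fin: "finite ?V"
    by (rule pair_finite_verts)
  have AV: "A \<subseteq> ?V" and V: "?V = A \<union> B" "A \<inter> B = {}" "finite A" "finite B"
    using fin by (auto simp: A_def B_def)
  have degrees: "2 * k \<le> card (out_nbrs T x)" "2 * k \<le> card (in_nbrs T x)"
    "card (out_nbrs T x) + card (in_nbrs T x) = 4 * k + 1" if "x \<in> ?V" for x
    using simplicity_index_le_card_nbrs[OF that] card_out_add_card_in[OF that] assms by auto
  \<comment> \<open>Being at least \<open>2 * k\<close> with sum \<open>4 * k + 1\<close>, the two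
    degrees are \<open>2 * k\<close> and \<open>2 * k + 1\<close> in some order.\<close>
  have deg_A: "card (out_nbrs T x) = 2 * k" "card (in_nbrs T x) = 2 * k + 1" if "x \<in> A" for x
    using that degrees[of x] by (auto simp: A_def)
  have deg_B: "card (out_nbrs T x) = 2 * k + 1" "card (in_nbrs T x) = 2 * k" if "x \<in> B" for x
    using that degrees[of x] by (auto simp: A_def B_def)
  \<comment> \<open>After cancellation, this equality of the two degree sums says that
    \<open>A\<close> and \<open>B\<close> have the same size.\<close>
  have "card A * (2 * k) + card B * (2 * k + 1) = card A * (2 * k + 1) + card B * (2 * k)"
    using sum_card_out_eq_in unfolding V(1) sum.union_disjoint[OF V(3,4,2)] by (simp add: deg_A deg_B)
  moreover have "card A + card B = 4 * k + 2"
    using assms(3) V by (simp add: card_Un_disjoint)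
  ultimately have "card B = 2 * k + 1"
    by (simp add: algebra_simps)
  interpret D: tournament ?D
    by (rule tournament_add_vertex[OF AV])
  have out_D: "card (out_nbrs ?D x) = 2 * k + 1" if "x \<in> pverts ?D" for x
  proof (cases x)
    case None
    then show ?thesis
      using \<open>card B = 2 * k + 1\<close> by (simp add: out_nbrs_add_vertex card_image flip: B_def)
  next
    case (Some y)
    then have "y \<in> ?V"
      using that by (auto simp: pverts_add_vertex)
    then show ?thesis
      using Some deg_A[of y] deg_B[of y] V(1) finite_nbrs(1)[of y]
      by (cases "y \<in> A") (auto simp: out_nbrs_add_vertex card_image)
  qed
  have "card (out_nbrs ?D x \<inter> out_nbrs ?D y) \<le> k"
    if xy: "x \<in> pverts ?D - {None}" "y \<in> pverts ?D - {None}" "x \<noteq> y" for x y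
  proof -
    obtain a b where ab: "x = Some a" "y = Some b" "a \<in> ?V" "b \<in> ?V" "a \<noteq> b"
      using xy by (auto simp: pverts_add_vertex)
    have "2 * k \<le> card (separators T a b)"
      using simplicity_index_le_card_separators[OF ab(3-5)] assms by simp
    also have "\<dots> = card (Some ` separators T a b)"
      by (simp add: card_image)
    \<comment> \<open>Separators in \<open>T\<close> still separate in \<open>?D\<close>, where
      \<open>None\<close> may be one more.\<close>
    also have "\<dots> \<le> card (separators ?D x y)"
      by (intro card_mono finite_subset[OF _ D.pair_finite_verts])
        (auto simp: separators_def ab parcs_add_vertex dest: D.in_arcsD1 D.in_arcsD2)
    finally have "2 * k \<le> card (separators ?D x y)" .
    moreover have "2 * card (out_nbrs ?D x \<inter> out_nbrs ?D y) + card (separators ?D x y) + 1 =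
        2 * (2 * k + 1)"
      using D.card_common_out_separators[of x y] out_D[of x] out_D[of y] xy by simp
    \<comment> \<open>Twice the number of common out-neighbours is at most \<open>2 * k + 1\<close>;
      parity lowers this to \<open>2 * k\<close>.\<close>
    ultimately show ?thesis
      by presburger
  qed
  moreover have "card (pverts ?D) = 4 * k + 3"
    using assms(3) fin by (simp add: pverts_add_vertex card_image)
  ultimately have "doubly_regular_tournament ?D"
    using out_D assms(1) by (intro D.doubly_regularI[of k None]) (auto simp: pverts_add_vertex)
  then show ?thesis
    unfolding doubly_regular_minus_vertex_def
    using digraph_iso_add_vertex[OF AV] pverts_add_vertex[of T A] by blast
qed

end
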